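(* The new inequalities (defined in the context) subsume the submodular inequalities. That is, for every $\bar X\subseteq V_1$, the submodular inequality $$\theta_\omega\le\sigma_\omega(\bar X)+\sum_{j\in V_1\setminus\bar X}\rho_j^\omega(\bar X)x_j$$ is a new inequality for some admissible choice of the parameters $D$, $c$, $C_1^k$, $C_2^k$ ($k=1,\dots,c$), i.e., the right-hand sides of the two inequalities coincide as affine functions of $x$.
   Context: Fix a bipartite directed graph (live-arc graph of scenario $\omega$) $G_\omega=(V_1\cup V_2,E_\omega)$ with $V_1=\{1,\dots,n\}$, $V_2=\{1,\dots,m\}$ and all arcs $(i,j)\in E_\omega$ going from $i\in V_1$ to $j\in V_2$. For $S\subseteq V_1$, $\sigma_\omega(S)$ is the number of nodes $j\in V_2$ such that $(i,j)\in E_\omega$ for some $i\in S$, and for $j\in V_1\setminus S$, $\rho_j^\omega(S)=\sigma_\omega(S\cup\{j\})-\sigma_\omega(S)$. For disjoint $B,N\subseteq V_1$, $\mathcal{U}_\omega(B,N)=\{j\in V_2:(i,j)\in E_\omega\ \forall i\in B;\ (i,j)\notin E_\omega\ \forall i\in N\}$. For $k\in V_1$, $\eta_\omega^k=|\mathcal{U}_\omega(\{k\},V_1\setminus\{k\})|$. Admissible parameters are: a set $D\subseteq V_1$, an integer $c\in\mathbb{Z}_+$, and sets $C_1^k\subseteq V_1$, $C_2^k\subseteq V_2$ for $k=1,\dots,c$ such that $|C_1^k|\ge2$; for each $k$ there is $n_\omega(C_1^k)\in\mathbb{Z}_+$ with $|\mathcal{U}_\omega(\{i,j\},V_1\setminus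 C_1^k)\cap C_2^k|=n_\omega(C_1^k)$ for every pair of distinct nodes $\{i,j\}\subseteq C_1^k$; and $C_2^i\cap C_2^j=\emptyset$ for $i\ne j$. The new inequality for these parameters is $$\theta_\omega\le\sum_{k=1}^{c}n_\omega(C_1^k)\Big(1-\sum_{j\in C_1^k}x_j\Big)+\sum_{k\in D}\eta_\omega^k(1-x_k)+\sum_{j\in V_1}\sigma_\omega(\{j\})x_j.$$ *)

theory Defs
  imports Complex_Main
begin

text \<open>
  The live-arc graph of the (fixed) scenario is given by \<open>n\<close>, \<open>m\<close> and its arc set \<open>E\<close>.
  The two sides \<open>V1 n = {1..n}\<close> and \<open>V2 m = {1..m}\<close> overlap as sets of numbers; they are kept
  apart by position: a pair \<open>(i, j)\<close> in \<open>E\<close> is the arc from node \<open>i\<close> of the first side to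
  node \<open>j\<close> of the second.
\<close>

definition V1 :: "nat \<Rightarrow> nat set" where
  "V1 n = {1..n}"

definition V2 :: "nat \<Rightarrow> nat set" where
  "V2 m = {1..m}"

definition live_arc_graph :: "nat \<Rightarrow> nat \<Rightarrow> (nat \<times> nat) set \<Rightarrow> bool" where
  "live_arc_graph n m E \<longleftrightarrow> E \<subseteq> V1 n \<times> V2 m"

definition sigma :: "nat \<Rightarrow> (nat \<times> nat) set \<Rightarrow> nat set \<Rightarrow> nat" where
  "sigma m E S = card {j \<in> V2 m. \<exists>i\<in>S. (i, j) \<in> E}"

definition rho :: "nat \<Rightarrow> (nat \<times> nat) set \<Rightarrow> nat \<Rightarrow> nat set \<Rightarrow> int" where
  "rho m E j S = int (sigma m E (S \<union> {j})) - int (sigma m E S)"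

definition U :: "nat \<Rightarrow> (nat \<times> nat) set \<Rightarrow> nat set \<Rightarrow> nat set \<Rightarrow> nat set" where
  "U m E B N = {j \<in> V2 m. (\<forall>i\<in>B. (i, j) \<in> E) \<and> (\<forall>i\<in>N. (i, j) \<notin> E)}"

definition eta :: "nat \<Rightarrow> nat \<Rightarrow> (nat \<times> nat) set \<Rightarrow> nat \<Rightarrow> nat" where
  "eta n m E k = card (U m E {k} (V1 n - {k}))"

text \<open>
  \<open>nC k\<close> stands for the common cardinality attached to the \<open>k\<close>-th pair \<open>(C1 k, C2 k)\<close>.  It
  depends on \<open>C2 k\<close> as well as on \<open>C1 k\<close>, hence the index \<open>k\<close>; it is uniquely determined
  because \<open>C1 k\<close> contains two distinct nodes.  The values of \<open>C1\<close>, \<open>C2\<close>, \<open>nC\<close> outside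
  \<open>{1..c}\<close> are irrelevant, and \<open>c = 0\<close> is allowed.
\<close>

definition admissible ::
  "nat \<Rightarrow> nat \<Rightarrow> (nat \<times> nat) set \<Rightarrow> nat set \<Rightarrow> nat \<Rightarrow> (nat \<Rightarrow> nat set) \<Rightarrow> (nat \<Rightarrow> nat set) \<Rightarrow>
    (nat \<Rightarrow> nat) \<Rightarrow> bool" where
  "admissible n m E D c C1 C2 nC \<longleftrightarrow>
     D \<subseteq> V1 n \<and>
     (\<forall>k\<in>{1..c}. C1 k \<subseteq> V1 n \<and> C2 k \<subseteq> V2 m \<and> card (C1 k) \<ge> 2) \<and>
     (\<forall>k\<in>{1..c}. \<forall>i\<in>C1 k. \<forall>j\<in>C1 k. i \<noteq> j \<longrightarrow>
        card (U m E {i, j} (V1 n - C1 k) \<inter> C2 k) = nC k) \<and>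
     (\<forall>i\<in>{1..c}. \<forall>j\<in>{1..c}. i \<noteq> j \<longrightarrow> C2 i \<inter> C2 j = {})"

text \<open>
  Right-hand sides of the two inequalities, as affine functions of \<open>x\<close>.  A point of
  \<open>n\<close>-dimensional real space is a function of which only the values on \<open>V1 n\<close> are used.
\<close>

definition new_rhs ::
  "nat \<Rightarrow> nat \<Rightarrow> (nat \<times> nat) set \<Rightarrow> nat set \<Rightarrow> nat \<Rightarrow> (nat \<Rightarrow> nat set) \<Rightarrow> (nat \<Rightarrow> nat) \<Rightarrow>
    (nat \<Rightarrow> real) \<Rightarrow> real" where
  "new_rhs n m E D c C1 nC x =
     (\<Sum>k=1..c. real (nC k) * (1 - (\<Sum>j\<in>C1 k. x j))) +
     (\<Sum>k\<in>D. real (eta n m E k) * (1 - x k)) +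
     (\<Sum>j\<in>V1 n. real (sigma m E {j}) * x j)"

definition submodular_rhs ::
  "nat \<Rightarrow> nat \<Rightarrow> (nat \<times> nat) set \<Rightarrow> nat set \<Rightarrow> (nat \<Rightarrow> real) \<Rightarrow> real" where
  "submodular_rhs n m E X x =
     real (sigma m E X) + (\<Sum>j\<in>V1 n - X. real_of_int (rho m E j X) * x j)"

end

theory Submission
  imports Defs
begin

text \<open>
  Both right-hand sides are sums of contributions of the single nodes \<open>j\<close> of the second side, and
  they agree node by node.  Let \<open>N j\<close> be the set of in-neighbours of \<open>j\<close>.  In the submodular
  inequality of \<open>X\<close>, the node \<open>j\<close> contributes the constant \<open>1\<close> if it is covered, that is, if
  \<open>N j\<close> meets \<open>X\<close>, and \<open>\<Sum>i\<in>N j. x i\<close> otherwise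
  (lemma \<open>submodular_rhs_eq_node_sum\<close>).  In a new inequality the
  last sum already contributes \<open>\<Sum>i\<in>N j. x i\<close> for every \<open>j\<close>, so what is missing is the term
  \<open>1 - (\<Sum>i\<in>N j. x i)\<close> for each covered \<open>j\<close>.

  If \<open>N j\<close> is a singleton \<open>{k}\<close>, then \<open>j\<close> is covered iff \<open>k \<in> X\<close>, and the missing term
  \<open>1 - x k\<close> is supplied by \<open>eta\<close> once \<open>D = X\<close> (lemma \<open>eta_sum_eq_node_sum\<close>).  If \<open>N j\<close> has at
  least two elements, the pair \<open>C1 = N j\<close>, \<open>C2 = {j}\<close> has common cardinality \<open>1\<close> and supplies
  exactly the missing term (lemma \<open>card_U_Int_in_nbrs\<close>).  Hence it suffices to take one such pair
  for each covered node of in-degree at least two.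
\<close>

definition in_nbrs :: "(nat \<times> nat) set \<Rightarrow> nat \<Rightarrow> nat set" where
  "in_nbrs E j = {i. (i, j) \<in> E}"

lemma in_nbrs_subset_V1: "live_arc_graph n m E \<Longrightarrow> in_nbrs E j \<subseteq> V1 n"
  by (auto simp: live_arc_graph_def in_nbrs_def)

lemma finite_V1 [simp]: "finite (V1 n)"
  by (simp add: V1_def)

lemma finite_V2 [simp]: "finite (V2 m)"
  by (simp add: V2_def)

lemma real_card_filter:
  "finite A \<Longrightarrow> real (card {j \<in> A. P j}) = (\<Sum>j\<in>A. of_bool (P j))"
  by (simp add: of_bool_def sum.If_cases Int_def)

lemma sigma_eq_node_sum:
  "real (sigma m E S) = (\<Sum>j\<in>V2 m. of_bool (in_nbrs E j \<inter> S \<noteq> {}))"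
proof -
  have "sigma m E S = card {j \<in> V2 m. in_nbrs E j \<inter> S \<noteq> {}}"
    unfolding sigma_def in_nbrs_def by (rule arg_cong[of _ _ card]) auto
  then show ?thesis by (simp add: real_card_filter)
qed

text \<open>
  Adding \<open>k\<close> to \<open>X\<close> newly covers exactly the uncovered nodes that have \<open>k\<close> as an in-neighbour.
\<close>

lemma rho_eq_node_sum:
  "real_of_int (rho m E k X) =
    (\<Sum>j\<in>V2 m. of_bool (in_nbrs E j \<inter> X = {} \<and> k \<in> in_nbrs E j))"
proof -
  have "real_of_int (rho m E k X) = real (sigma m E (X \<union> {k})) - real (sigma m E X)"
    by (simp add: rho_def)
  also have "\<dots> = (\<Sum>j\<in>V2 m. of_bool (in_nbrs E j \<inter> (X \<union> {k}) \<noteq> {})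
                             - of_bool (in_nbrs E j \<inter> X \<noteq> {}))"
    by (simp only: sigma_eq_node_sum sum_subtractf)
  also have "\<dots> = (\<Sum>j\<in>V2 m. of_bool (in_nbrs E j \<inter> X = {} \<and> k \<in> in_nbrs E j))"
    by (rule sum.cong) auto
  finally show ?thesis .
qed

lemma eta_eq_node_sum:
  assumes "live_arc_graph n m E" "k \<in> V1 n"
  shows "real (eta n m E k) = (\<Sum>j\<in>V2 m. of_bool (in_nbrs E j = {k}))"
proof -
  have "U m E {k} (V1 n - {k}) = {j \<in> V2 m. in_nbrs E j = {k}}"
    using assms unfolding U_def in_nbrs_def live_arc_graph_def by blast
  then show ?thesis by (simp add: eta_def real_card_filter)
qed

lemma sum_of_bool_mult_restrict:
  fixes x :: "'a \<Rightarrow> real"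
  assumes "finite A" "B \<subseteq> A"
  shows "(\<Sum>i\<in>A. of_bool (i \<in> B) * x i) = (\<Sum>i\<in>B. x i)"
  using assms by (simp add: of_bool_def if_distrib[of "\<lambda>c. c * _"] sum.If_cases
      Int_absorb1 cong: if_cong)

lemma sigma_singleton_sum_eq_node_sum:
  fixes x :: "nat \<Rightarrow> real"
  assumes "live_arc_graph n m E"
  shows "(\<Sum>i\<in>V1 n. real (sigma m E {i}) * x i) = (\<Sum>j\<in>V2 m. \<Sum>i\<in>in_nbrs E j. x i)"
proof -
  have "(\<Sum>i\<in>V1 n. real (sigma m E {i}) * x i)
      = (\<Sum>i\<in>V1 n. \<Sum>j\<in>V2 m. of_bool (i \<in> in_nbrs E j) * x i)"
    by (simp add: sigma_eq_node_sum sum_distrib_right)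
  also have "\<dots> = (\<Sum>j\<in>V2 m. \<Sum>i\<in>V1 n. of_bool (i \<in> in_nbrs E j) * x i)"
    by (rule sum.swap)
  also have "\<dots> = (\<Sum>j\<in>V2 m. \<Sum>i\<in>in_nbrs E j. x i)"
    using in_nbrs_subset_V1[OF assms] by (simp only: sum_of_bool_mult_restrict finite_V1)
  finally show ?thesis .
qed

lemma submodular_rhs_eq_node_sum:
  assumes "live_arc_graph n m E"
  shows "submodular_rhs n m E X x =
    (\<Sum>j\<in>V2 m. if in_nbrs E j \<inter> X = {} then \<Sum>i\<in>in_nbrs E j. x i else 1)"
proof -
  have "(\<Sum>k\<in>V1 n - X. real_of_int (rho m E k X) * x k)
      = (\<Sum>k\<in>V1 n - X. \<Sum>j\<in>V2 m. of_bool (in_nbrs E j \<inter> X = {} \<and> k \<in> in_nbrs E j) * x k)"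
    by (simp add: rho_eq_node_sum sum_distrib_right)
  also have "\<dots> = (\<Sum>j\<in>V2 m. \<Sum>k\<in>V1 n - X.
                    of_bool (in_nbrs E j \<inter> X = {} \<and> k \<in> in_nbrs E j) * x k)"
    by (rule sum.swap)
  also have "\<dots> = (\<Sum>j\<in>V2 m. if in_nbrs E j \<inter> X = {} then \<Sum>i\<in>in_nbrs E j. x i else 0)"
  proof (rule sum.cong)
    fix j
    \<comment> \<open>The in-neighbours of an uncovered node all lie outside \<open>X\<close>, so none of its terms is lost
      by summing only over \<open>V1 n - X\<close>.\<close>
    have "in_nbrs E j \<subseteq> V1 n - X" if "in_nbrs E j \<inter> X = {}"
      using that in_nbrs_subset_V1[OF assms] by blast
    then show "(\<Sum>k\<in>V1 n - X. of_bool (in_nbrs E j \<inter> X = {} \<and> k \<in> in_nbrs E j) * x k)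
        = (if in_nbrs E j \<inter> X = {} then \<Sum>i\<in>in_nbrs E j. x i else 0)"
      using sum_of_bool_mult_restrict[of "V1 n - X" "in_nbrs E j" x] by simp
  qed simp
  finally have "submodular_rhs n m E X x = (\<Sum>j\<in>V2 m. of_bool (in_nbrs E j \<inter> X \<noteq> {}) +
        (if in_nbrs E j \<inter> X = {} then \<Sum>i\<in>in_nbrs E j. x i else 0))"
    by (simp only: submodular_rhs_def sigma_eq_node_sum sum.distrib)
  also have "\<dots> = (\<Sum>j\<in>V2 m. if in_nbrs E j \<inter> X = {} then \<Sum>i\<in>in_nbrs E j. x i else 1)"
    by (rule sum.cong) auto
  finally show ?thesis .
qed

text \<open>
  With \<open>D = X\<close>, each covered node of in-degree one is counted by \<open>eta\<close> for exactly one \<open>k \<in> X\<close>,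
  namely its only in-neighbour.
\<close>

lemma eta_sum_eq_node_sum:
  assumes "live_arc_graph n m E" "X \<subseteq> V1 n"
  shows "(\<Sum>k\<in>X. real (eta n m E k) * (1 - x k)) =
    (\<Sum>j\<in>V2 m. if in_nbrs E j \<inter> X \<noteq> {} \<and> card (in_nbrs E j) = 1
                then 1 - (\<Sum>i\<in>in_nbrs E j. x i) else 0)"
proof -
  have fin: "finite X" using assms(2) by (rule finite_subset) simp
  have "(\<Sum>k\<in>X. real (eta n m E k) * (1 - x k))
      = (\<Sum>k\<in>X. \<Sum>j\<in>V2 m. of_bool (in_nbrs E j = {k}) * (1 - x k))"
    using assms by (intro sum.cong refl)
      (simp only: eta_eq_node_sum[OF assms(1) subsetD[OF assms(2)]] sum_distrib_right)
  also have "\<dots> = (\<Sum>j\<in>V2 m. \<Sum>k\<in>X. of_bool (in_nbrs E j = {k}) * (1 - x k))"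
    by (rule sum.swap)
  also have "\<dots> = (\<Sum>j\<in>V2 m. if in_nbrs E j \<inter> X \<noteq> {} \<and> card (in_nbrs E j) = 1
                              then 1 - (\<Sum>i\<in>in_nbrs E j. x i) else 0)"
  proof (rule sum.cong)
    fix j
    show "(\<Sum>k\<in>X. of_bool (in_nbrs E j = {k}) * (1 - x k))
        = (if in_nbrs E j \<inter> X \<noteq> {} \<and> card (in_nbrs E j) = 1
           then 1 - (\<Sum>i\<in>in_nbrs E j. x i) else 0)"
    proof (cases "card (in_nbrs E j) = 1")
      case True
      then obtain l where l: "in_nbrs E j = {l}" by (auto simp: card_1_singleton_iff)
      have "(\<Sum>k\<in>X. of_bool (in_nbrs E j = {k}) * (1 - x k))
          = (\<Sum>k\<in>X. if l = k then 1 - x k else 0)"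
        by (rule sum.cong) (auto simp: l)
      then show ?thesis using fin by (simp add: l)
    next
      case False
      then have "in_nbrs E j \<noteq> {k}" for k by auto
      then show ?thesis using False by simp
    qed
  qed simp
  finally show ?thesis .
qed

text \<open>
  A node is adjacent to every node of its own in-neighbourhood and to no other, so intersecting
  with \<open>{j}\<close> leaves \<open>j\<close> itself, whichever pair is chosen.
\<close>

lemma card_U_Int_in_nbrs:
  assumes "j \<in> V2 m" "B \<subseteq> in_nbrs E j"
  shows "card (U m E B (V1 n - in_nbrs E j) \<inter> {j}) = 1"
proof -
  have "U m E B (V1 n - in_nbrs E j) \<inter> {j} = {j}"
    using assms by (auto simp: U_def in_nbrs_def)
  then show ?thesis by simp
qed

theorem proposition3p5:
  fixes n m :: nat and E :: "(nat \<times> nat) set" and X :: "nat set"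
  assumes "live_arc_graph n m E"
    and "X \<subseteq> V1 n"
  shows "\<exists>D c C1 C2 nC. admissible n m E D c C1 C2 nC \<and>
           (\<forall>x :: nat \<Rightarrow> real. submodular_rhs n m E X x = new_rhs n m E D c C1 nC x)"
proof -
  define J where "J = {j \<in> V2 m. in_nbrs E j \<inter> X \<noteq> {} \<and> card (in_nbrs E j) \<ge> 2}"
  have "finite J" by (simp add: J_def)
  then obtain f where f: "bij_betw f {1..card J} J"
    using ex_bij_betw_nat_finite_1 by blast
  have fJ: "f k \<in> J" if "k \<in> {1..card J}" for k
    using bij_betwE[OF f] that by blast
  have "admissible n m E X (card J) (\<lambda>k. in_nbrs E (f k)) (\<lambda>k. {f k}) (\<lambda>_. 1)"
    unfolding admissible_def
  proof (intro conjI ballI impI)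
    fix i k assume "i \<in> {1..card J}" "k \<in> {1..card J}" "i \<noteq> k"
    then show "{f i} \<inter> {f k} = {}"
      using bij_betw_imp_inj_on[OF f] by (auto dest: inj_onD)
  next
    fix k i j assume "k \<in> {1..card J}" "i \<in> in_nbrs E (f k)" "j \<in> in_nbrs E (f k)"
    then show "card (U m E {i, j} (V1 n - in_nbrs E (f k)) \<inter> {f k}) = 1"
      using fJ by (intro card_U_Int_in_nbrs) (auto simp: J_def)
  next
    fix k assume "k \<in> {1..card J}"
    then have "f k \<in> J" by (rule fJ)
    then show "{f k} \<subseteq> V2 m" "card (in_nbrs E (f k)) \<ge> 2"
      by (auto simp: J_def)
    show "in_nbrs E (f k) \<subseteq> V1 n"
      using assms(1) by (rule in_nbrs_subset_V1)
  qed (rule assms(2))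
  moreover have "submodular_rhs n m E X x
      = new_rhs n m E X (card J) (\<lambda>k. in_nbrs E (f k)) (\<lambda>_. 1) x" for x
  proof -
    let ?s = "\<lambda>j. \<Sum>i\<in>in_nbrs E j. x i"
    have "(\<Sum>k=1..card J. 1 - ?s (f k)) = (\<Sum>j\<in>J. 1 - ?s j)"
      using f by (rule sum.reindex_bij_betw)
    also have "\<dots> = (\<Sum>j\<in>V2 m. if in_nbrs E j \<inter> X \<noteq> {} \<and> card (in_nbrs E j) \<ge> 2
                                then 1 - ?s j else 0)"
      unfolding J_def by (simp add: sum.inter_filter)
    finally have pairs: "(\<Sum>k=1..card J. 1 - ?s (f k)) = \<dots>" .
    have node: "(if in_nbrs E j \<inter> X = {} then ?s j else 1)
        = (if in_nbrs E j \<inter> X \<noteq> {} \<and> card (in_nbrs E j) \<ge> 2 then 1 - ?s j else 0)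
        + (if in_nbrs E j \<inter> X \<noteq> {} \<and> card (in_nbrs E j) = 1 then 1 - ?s j else 0) + ?s j"
      for j
    proof -
      have "finite (in_nbrs E j)"
        using in_nbrs_subset_V1[OF assms(1)] by (rule finite_subset) simp
      then have "card (in_nbrs E j) \<noteq> 0" if "in_nbrs E j \<inter> X \<noteq> {}"
        using that by auto
      then consider "in_nbrs E j \<inter> X = {}"
        | "in_nbrs E j \<inter> X \<noteq> {}" "card (in_nbrs E j) = 1"
        | "in_nbrs E j \<inter> X \<noteq> {}" "card (in_nbrs E j) \<ge> 2"
        by linarith
      then show ?thesis by cases simp_all
    qed
    show ?thesis
      unfolding submodular_rhs_eq_node_sum[OF assms(1)] new_rhs_def
        eta_sum_eq_node_sum[OF assms] sigma_singleton_sum_eq_node_sum[OF assms(1)]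
      by (simp only: of_nat_1 mult_1 pairs node sum.distrib)
  qed
  ultimately show ?thesis by blast
qed

end
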